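(* Let $n$ be a positive integer, let $f:X\to Y$ and $g:Y\to Z$ be continuous maps and let $B\subseteq X$, so that $f:(X,B)\to(Y,f(B))$ and $g:(Y,f(B))\to(Z,gf(B))$ are maps of pairs. Then $TC_n(gf,B)\le TC_n(f,B)$.
   Context: The homotopic distance $D(f_1,\dots,f_m)$ of continuous maps $f_1,\dots,f_m:X\to Y$ is the least integer $k\ge0$ for which there is an open cover $U_0,\dots,U_k$ of $X$ such that $f_j|_{U_i}\simeq f_l|_{U_i}$ for all $0\le i\le k$ and $1\le j,l\le m$ ($\infty$ if there is none). For a continuous map $f:X\to Y$ and $B\subseteq X$, put $\bar f=f\times f|_B:X\times B\to Y\times f(B)$, and let $\pi_i:X^n\times B^n\to X\times B$, $1\le i\le n$, be the projection onto the $i$th component, $\pi_i(x_1,\dots,x_n,b_1,\dots,b_n)=(x_i,b_i)$. The $n$-dimensional targeted complexity of $f$ is $TC_n(f,B)=D(\bar f\pi_1,\bar f\pi_2,\dots,\bar f\pi_n)$. *)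

theory Defs
  imports "HOL-Analysis.Analysis" "HOL-Library.Extended_Nat"
begin

text \<open>
  Spaces are abstract topologies; a map between them is a function together with its source and
  target topologies. Since \<^const>\<open>homotopic_with\<close> over \<^term>\<open>subtopology X (U i)\<close> only
  depends on values on \<^term>\<open>topspace X \<inter> U i\<close>, no explicit restriction of the maps
  to \<^term>\<open>U i\<close> is needed. The infimum of the empty set in \<^typ>\<open>enat\<close> is
  \<^term>\<open>\<infinity>::enat\<close>.
\<close>

definition homotopic_distance ::
    "'a topology \<Rightarrow> 'b topology \<Rightarrow> nat \<Rightarrow> (nat \<Rightarrow> 'a \<Rightarrow> 'b) \<Rightarrow> enat" where
  "homotopic_distance X Y m F =
     Inf {enat k | k. \<exists>U :: nat \<Rightarrow> 'a set.
        (\<forall>i\<le>k. openin X (U i)) \<and> (\<Union>i\<le>k. U i) = topspace X \<and>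
        (\<forall>i\<le>k. \<forall>j\<in>{1..m}. \<forall>l\<in>{1..m}.
           homotopic_with (\<lambda>_. True) (subtopology X (U i)) Y (F j) (F l))}"

definition power_topology :: "nat \<Rightarrow> 'a topology \<Rightarrow> (nat \<Rightarrow> 'a) topology" where
  "power_topology n X = product_topology (\<lambda>_. X) {1..n}"

definition pair_proj :: "nat \<Rightarrow> (nat \<Rightarrow> 'a) \<times> (nat \<Rightarrow> 'a) \<Rightarrow> 'a \<times> 'a" where
  "pair_proj i = (\<lambda>(x, b). (x i, b i))"

text \<open>
  The map \<^term>\<open>map_prod f f\<close> is \<open>f \<times> f|B\<close>, the second factor being restricted through the
  topologies \<^term>\<open>subtopology X B\<close> (source) and \<^term>\<open>subtopology Y (f ` B)\<close> (target).
\<close>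

definition targeted_complexity ::
    "nat \<Rightarrow> 'a topology \<Rightarrow> 'b topology \<Rightarrow> ('a \<Rightarrow> 'b) \<Rightarrow> 'a set \<Rightarrow> enat" where
  "targeted_complexity n X Y f B =
     homotopic_distance
       (prod_topology (power_topology n X) (power_topology n (subtopology X B)))
       (prod_topology Y (subtopology Y (f ` B)))
       n (\<lambda>i. map_prod f f \<circ> pair_proj i)"

end

theory Submission
  imports Defs
begin

text \<open>
  Composing a homotopy with a continuous map on the left gives a homotopy of the composites, so
  every open cover that witnesses \<open>D(F\<^sub>1, \<dots>, F\<^sub>m) \<le> k\<close> also witnesses
  \<open>D(h F\<^sub>1, \<dots>, h F\<^sub>m) \<le> k\<close>; this is \<open>homotopic_distance_compose_left_le\<close>. The maps that
  define the targeted complexity of \<open>g f\<close> are those for \<open>f\<close> followed by \<open>g \<times> g\<close>, which is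
  continuous from \<open>Y \<times> f(B)\<close> to \<open>Z \<times> g(f(B))\<close>. The theorem is the case \<open>h = g \<times> g\<close>.
\<close>

lemma homotopic_distance_compose_left_le:
  fixes X :: "'a topology"
  assumes h: "continuous_map Y Z h"
  shows "homotopic_distance X Z m (\<lambda>j. h \<circ> F j) \<le> homotopic_distance X Y m F"
  unfolding homotopic_distance_def
proof (rule Inf_superset_mono, clarify)
  fix k :: nat and U :: "nat \<Rightarrow> 'a set"
  assume "\<forall>i\<le>k. openin X (U i)" "(\<Union>i\<le>k. U i) = topspace X"
    and homotopic: "\<forall>i\<le>k. \<forall>j\<in>{1..m}. \<forall>l\<in>{1..m}.
      homotopic_with (\<lambda>_. True) (subtopology X (U i)) Y (F j) (F l)"
  moreover have "\<forall>i\<le>k. \<forall>j\<in>{1..m}. \<forall>l\<in>{1..m}.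
      homotopic_with (\<lambda>_. True) (subtopology X (U i)) Z (h \<circ> F j) (h \<circ> F l)"
    using homotopic by (auto intro: homotopic_with_compose_continuous_map_left[OF _ h])
  ultimately show "\<exists>k'. enat k = enat k' \<and> (\<exists>U. (\<forall>i\<le>k'. openin X (U i)) \<and>
      (\<Union>i\<le>k'. U i) = topspace X \<and> (\<forall>i\<le>k'. \<forall>j\<in>{1..m}. \<forall>l\<in>{1..m}.
        homotopic_with (\<lambda>_. True) (subtopology X (U i)) Z (h \<circ> F j) (h \<circ> F l)))"
    by (intro exI[of _ k] exI[of _ U] conjI refl)
qed

lemma continuous_map_restrict_image:
  assumes "continuous_map Y Z g"
  shows "continuous_map (subtopology Y A) (subtopology Z (g ` A)) g"
  using assms
  by (intro continuous_map_into_subtopology continuous_map_from_subtopology) auto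

theorem proposition6p4:
  fixes X :: "'a topology" and Y :: "'b topology" and Z :: "'c topology"
    and f :: "'a \<Rightarrow> 'b" and g :: "'b \<Rightarrow> 'c" and B :: "'a set" and n :: nat
  assumes "n \<ge> 1"
    and "continuous_map X Y f"
    and "continuous_map Y Z g"
    and "B \<subseteq> topspace X"
  shows "targeted_complexity n X Z (g \<circ> f) B \<le> targeted_complexity n X Y f B"
proof -
  have cont: "continuous_map (prod_topology Y (subtopology Y (f ` B)))
      (prod_topology Z (subtopology Z ((g \<circ> f) ` B))) (map_prod g g)"
    unfolding map_prod_def
    using assms(3) continuous_map_restrict_image[OF assms(3), of "f ` B"]
    by (simp add: continuous_map_prod_top image_comp)
  have factor: "map_prod (g \<circ> f) (g \<circ> f) \<circ> pair_proj i = map_prod g g \<circ> (map_prod f f \<circ> pair_proj i)"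
    for i
    by (simp add: map_prod.comp comp_assoc[symmetric])
  show ?thesis
    unfolding targeted_complexity_def factor
    by (rule homotopic_distance_compose_left_le[OF cont])
qed

end
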